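(* Let \(\lambda\) be a weakly inaccessible cardinal with \(2^{<\lambda} = \lambda\). Let \(U\) be a weakly normal ultrafilter on \(\lambda\) such that \(\{\gamma < \lambda : 2^{\mathrm{cf}(\gamma)} \leq \gamma\} \in U\). Then \(\diamondsuit^-(U)\) holds.
   Context: A countably complete uniform ultrafilter \(U\) on a regular cardinal \(\lambda\) is weakly normal if whenever \(f\) is a function with \(f(\alpha) < \alpha\) for all \(\alpha\) in some set in \(U\), there is \(\beta < \lambda\) such that \(\{\alpha < \lambda : f(\alpha) < \beta\} \in U\); equivalently, in the ultrapower \(j_U : V \to M_U\), \([\mathrm{id}]_U = \sup j_U[\lambda]\). For a filter \(F\) on \(\lambda\), \(F^+\) denotes the collection of \(F\)-positive sets (sets whose complement is not in \(F\)). The principle \(\diamondsuit^-(F)\) states: there is a sequence \(\langle \mathcal S_\alpha : \alpha < \lambda\rangle\) of sets with \(|\mathcal S_\alpha| \leq \alpha\) for all \(\alpha < \lambda\) such that for every \(A \subseteq \lambda\), \(\{\alpha < \lambda : A \cap \alpha \in \mathcal S_\alpha\} \in F^+\). *)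

theory Defs
  imports Main
begin

unbundle cardinal_syntax

text \<open>
  A cardinal \<open>\<lambda>\<close> is a relation \<open>r\<close> with \<open>Card_order r\<close>; the ordinals below \<open>\<lambda>\<close> are the elements of
  \<open>Field r\<close>, and such an ordinal \<open>\<alpha>\<close>, as the set of its predecessors, is \<open>underS r \<alpha>\<close>.  A filter on
  \<open>\<lambda>\<close> is a filter \<open>F \<le> principal (Field r)\<close>, and a set \<open>A\<close> belongs to it iff
  \<open>eventually (\<lambda>\<alpha>. \<alpha> \<in> A) F\<close>.
\<close>

text \<open>
  The ordinal \<open>\<alpha> < \<lambda>\<close> as a well-order in its own right, so that \<open>k \<le>o ordinal_at r \<alpha>\<close> is the comparison
  of ordinals \<open>k \<le> \<alpha>\<close>.
\<close>

definition ordinal_at :: "'a rel \<Rightarrow> 'a \<Rightarrow> 'a rel" where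
  "ordinal_at r \<alpha> = Restr r (underS r \<alpha>)"

text \<open>
  The non-strict version of \<^const>\<open>cofinal\<close>, which is the one giving successor ordinals cofinality 1;
  the two agree on limit ordinals.
\<close>

definition unbounded_in :: "'a set \<Rightarrow> 'a rel \<Rightarrow> bool" where
  "unbounded_in C s \<longleftrightarrow> C \<subseteq> Field s \<and> (\<forall>\<alpha>\<in>Field s. \<exists>\<beta>\<in>C. (\<alpha>, \<beta>) \<in> s)"

definition cofinality :: "'a rel \<Rightarrow> 'a rel" where
  "cofinality s = |SOME C. unbounded_in C s \<and> (\<forall>D. unbounded_in D s \<longrightarrow> |C| \<le>o |D| )|"

lemma cofinality_witness:
  assumes "Well_order s"
  shows "\<exists>C. unbounded_in C s \<and> cofinality s = |C| \<and> (\<forall>D. unbounded_in D s \<longrightarrow> |C| \<le>o |D| )"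
proof -
  have "unbounded_in (Field s) s"
    using wo_rel.REFL[unfolded wo_rel_def, OF assms] by (auto simp: unbounded_in_def refl_on_def)
  then have "{|C| | C. unbounded_in C s} \<noteq> {}" by auto
  moreover have "\<forall>k\<in>{|C| | C. unbounded_in C s}. Card_order k" by (auto simp: card_of_Card_order)
  ultimately have "\<exists>k\<in>{|C| | C. unbounded_in C s}. \<forall>k'\<in>{|C| | C. unbounded_in C s}. k \<le>o k'"
    by (rule exists_minim_Card_order)
  then have "\<exists>C. unbounded_in C s \<and> (\<forall>D. unbounded_in D s \<longrightarrow> |C| \<le>o |D| )" by auto
  from someI_ex[OF this] show ?thesis
    unfolding cofinality_def by blast
qed

definition weakly_inaccessible :: "'a rel \<Rightarrow> bool" where
  "weakly_inaccessible r \<longleftrightarrow>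
     Card_order r \<and> natLeq <o r \<and> regularCard r \<and>
     (\<forall>k :: 'a rel. Card_order k \<and> k <o r \<longrightarrow> cardSuc k <o r)"

text \<open>
  The cardinal \<open>s\<close> is the supremum of the set \<open>K\<close> of cardinals.  It suffices to compare with upper
  bounds living on the type of \<open>s\<close>, since every cardinal below \<open>s\<close> is represented there.
\<close>

definition is_card_Sup :: "'b rel set \<Rightarrow> 'a rel \<Rightarrow> bool" where
  "is_card_Sup K s \<longleftrightarrow>
     Card_order s \<and> (\<forall>k\<in>K. k \<le>o s) \<and>
     (\<forall>m :: 'a rel. Card_order m \<and> (\<forall>k\<in>K. k \<le>o m) \<longrightarrow> s \<le>o m)"

text \<open>\<open>s = 2\<^bsup><r\<^esup>\<close>, that is, \<open>s\<close> is the supremum of the cardinals \<open>2\<^bsup>k\<^esup>\<close> for cardinals \<open>k < r\<close>.\<close>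

definition is_weak_power_two :: "'a rel \<Rightarrow> 'b rel \<Rightarrow> bool" where
  "is_weak_power_two r s \<longleftrightarrow> is_card_Sup {ctwo ^c k | k :: 'a rel. Card_order k \<and> k <o r} s"

definition ultrafilter_on :: "'a set \<Rightarrow> 'a filter \<Rightarrow> bool" where
  "ultrafilter_on X F \<longleftrightarrow>
     F \<le> principal X \<and> F \<noteq> bot \<and>
     (\<forall>A. eventually (\<lambda>x. x \<in> A) F \<or> eventually (\<lambda>x. x \<notin> A) F)"

definition countably_complete :: "'a filter \<Rightarrow> bool" where
  "countably_complete F \<longleftrightarrow>
     (\<forall>A :: nat \<Rightarrow> 'a set. (\<forall>n. eventually (\<lambda>x. x \<in> A n) F) \<longrightarrow> eventually (\<lambda>x. x \<in> (\<Inter>n. A n)) F)"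

definition uniform_on :: "'a rel \<Rightarrow> 'a filter \<Rightarrow> bool" where
  "uniform_on r F \<longleftrightarrow> (\<forall>A \<subseteq> Field r. eventually (\<lambda>x. x \<in> A) F \<longrightarrow> |A| =o r)"

definition weakly_normal :: "'a rel \<Rightarrow> 'a filter \<Rightarrow> bool" where
  "weakly_normal r U \<longleftrightarrow>
     ultrafilter_on (Field r) U \<and> countably_complete U \<and> uniform_on r U \<and>
     (\<forall>f. eventually (\<lambda>\<alpha>. f \<alpha> \<in> underS r \<alpha>) U \<longrightarrow>
        (\<exists>\<beta>\<in>Field r. eventually (\<lambda>\<alpha>. f \<alpha> \<in> underS r \<beta>) U))"

text \<open>
  \<open>\<diamond>\<^sup>-(F)\<close>.  A set is \<open>F\<close>-positive, i.e.\ its complement is not in \<open>F\<close>, iff membership in it holds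
  \<^const>\<open>frequently\<close> along \<open>F\<close>.
\<close>

definition diamond_minus :: "'a rel \<Rightarrow> 'a filter \<Rightarrow> bool" where
  "diamond_minus r F \<longleftrightarrow>
     (\<exists>S :: 'a \<Rightarrow> 'a set set.
        (\<forall>\<alpha>\<in>Field r. |S \<alpha>| \<le>o ordinal_at r \<alpha>) \<and>
        (\<forall>A \<subseteq> Field r. frequently (\<lambda>\<alpha>. \<alpha> \<in> Field r \<and> A \<inter> underS r \<alpha> \<in> S \<alpha>) F))"

end

theory Submission
  imports Defs
begin

text \<open>
  In the ultrapower \<open>j : V \<rightarrow> M\<close> by \<open>U\<close>, let \<open>\<lambda>\<^sup>* = [id] = sup j[\<lambda>]\<close> and let \<open>C \<in> M\<close> be cofinal in
  \<open>\<lambda>\<^sup>*\<close> with \<open>|C| = cf(\<lambda>\<^sup>*)\<close>.  Choose a sparse cofinal \<open>P \<subseteq> \<lambda>\<close> such that \<open>C\<close> meets every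
  interval \<open>[j(p), j(g(p)))\<close>, \<open>p \<in> P\<close>, where \<open>g(p)\<close> is at most the next element of \<open>P\<close>.  The set \<open>B \<in> M\<close> of
  those \<open>p \<in> j(P)\<close> for which \<open>C\<close> meets \<open>[p, j(g)(p))\<close> covers \<open>j[P]\<close>, and \<open>|B| \<le> |C|\<close> since these
  intervals are disjoint.  As \<open>2\<^bsup><\<lambda>\<^esup> = \<lambda>\<close>, the bounded subsets of \<open>\<lambda>\<close> can be enumerated as
  \<open>\<langle>a\<^sub>p : p \<in> P\<rangle>\<close>.  For \<open>A \<subseteq> \<lambda>\<close>, the set \<open>j(A) \<inter> \<lambda>\<^sup>*\<close> is the union of the \<open>j(a)\<^sub>p \<inter> \<lambda>\<^sup>*\<close> over those
  \<open>p \<in> B\<close> for which this set is contained in \<open>j(A)\<close>, because each \<open>j(A \<inter> \<beta>)\<close>, \<open>\<beta> < \<lambda>\<close>, occurs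
  among them.  So \<open>j(A) \<inter> \<lambda>\<^sup>*\<close> belongs to a family in \<open>M\<close>, independent of \<open>A\<close>, of cardinality at
  most \<open>2\<^bsup>cf(\<lambda>\<^sup>*)\<^esup> \<le> \<lambda>\<^sup>*\<close>.  By Los's theorem each step is a
  statement about \<open>U\<close>-almost all \<open>\<gamma> < \<lambda>\<close>, with \<open>\<gamma>\<close> in the role of \<open>\<lambda>\<^sup>*\<close>.
\<close>

section \<open>Cardinal arithmetic, and bounded and sparse sets in a regular cardinal\<close>

lemma Pow_ordIso_ctwo_cexp: "|Pow A| =o ctwo ^c |A|"
  unfolding ctwo_def cexp_def Field_card_of by (rule card_of_Pow_Func)

lemma card_of_Pow_mono:
  assumes "|A| \<le>o |B|"
  shows "|Pow A| \<le>o |Pow B|"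
proof -
  obtain f where f: "inj_on f A" "f ` A \<subseteq> B" using assms card_of_ordLeq by metis
  have "inj_on ((`) f) (Pow A)" using f(1) by (rule inj_on_image_Pow)
  moreover have "(`) f ` Pow A \<subseteq> Pow B" using f(2) by blast
  ultimately show ?thesis using card_of_ordLeq by blast
qed

lemma Card_order_total:
  assumes "Card_order r" "a \<in> Field r" "b \<in> Field r" "(a, b) \<notin> r"
  shows "(b, a) \<in> r \<and> a \<noteq> b"
  using assms wo_rel.TOTALS[of r] unfolding wo_rel_def card_order_on_def by metis

lemma Card_order_trans_weak: "Card_order r \<Longrightarrow> (a, b) \<in> r \<Longrightarrow> (b, c) \<in> r \<Longrightarrow> (a, c) \<in> r"
  using wo_rel.TRANS[of r] unfolding wo_rel_def card_order_on_def by (blast dest: transD)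

lemma Card_order_antisym: "Card_order r \<Longrightarrow> (a, b) \<in> r \<Longrightarrow> (b, a) \<in> r \<Longrightarrow> a = b"
  using wo_rel.ANTISYM[of r] unfolding wo_rel_def card_order_on_def by (blast dest: antisymD)

lemma Card_order_refl: "Card_order r \<Longrightarrow> a \<in> Field r \<Longrightarrow> (a, a) \<in> r"
  using wo_rel.REFL[of r] unfolding wo_rel_def card_order_on_def by (blast dest: refl_onD)

lemma Card_order_not_less:
  assumes "Card_order r" "a \<in> Field r" "b \<in> Field r" "a = b \<or> (a, b) \<notin> r"
  shows "(b, a) \<in> r"
  using assms Card_order_total by metis

lemma card_of_under:
  assumes r: "Card_order r" and inf: "infinite (Field r)" and a: "a \<in> Field r"
  shows "|under r a| <o r"
proof -
  obtain b where b: "b \<in> Field r" "a \<noteq> b" "(a, b) \<in> r"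
    using infinite_Card_order_limit[OF r inf a] by blast
  have "under r a \<subseteq> underS r b"
    using b Card_order_trans_weak[OF r] Card_order_antisym[OF r]
    unfolding under_def underS_def by blast
  then show ?thesis
    using card_of_mono1 card_of_underS[OF r b(1)] ordLeq_ordLess_trans by blast
qed

lemma regularCard_bounded:
  assumes r: "Card_order r" and inf: "infinite (Field r)" and reg: "regularCard r"
    and K: "K \<subseteq> Field r" "|K| <o r"
  shows "\<exists>b\<in>Field r. \<forall>k\<in>K. k \<in> underS r b"
proof -
  have "\<not> cofinal K r"
    using reg K unfolding regularCard_def using not_ordLess_ordIso by blast
  then obtain q where q: "q \<in> Field r" "\<forall>b\<in>K. q = b \<or> (q, b) \<notin> r"
    unfolding cofinal_def by blast
  \<comment> \<open>\<open>q\<close> is only a weak upper bound of \<open>K\<close>; an infinite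
    cardinal is a limit, which gives a strict one.\<close>
  obtain b where b: "b \<in> Field r" "q \<noteq> b" "(q, b) \<in> r"
    using infinite_Card_order_limit[OF r inf q(1)] by blast
  have "(k, q) \<in> r" if "k \<in> K" for k
    using that K(1) q by (intro Card_order_not_less[OF r]) auto
  then have "\<forall>k\<in>K. k \<in> underS r b"
    using b Card_order_trans_weak[OF r] Card_order_antisym[OF r]
    unfolding underS_def by blast
  with b(1) show ?thesis by blast
qed

text \<open>Zorn's lemma gives a maximal \<open>P\<close> with the gap property. Were it not
  cofinal, it would be small, so regularity would bound \<open>P\<close> and its image under
  \<open>g\<close> by some \<open>b\<close> that could be added. Cofinality then forces full
  size.\<close>

lemma sparse_subset:
  assumes r: "Card_order r" and inf: "infinite (Field r)" and reg: "regularCard r"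
    and g: "g ` Field r \<subseteq> Field r"
  obtains P where "P \<subseteq> Field r" "|P| =o r"
    "\<And>p q. p \<in> P \<Longrightarrow> q \<in> P \<Longrightarrow> p \<noteq> q \<Longrightarrow> (p, q) \<in> r \<Longrightarrow> (g p, q) \<in> r"
proof -
  define F where
    "F = {P. P \<subseteq> Field r \<and> (\<forall>p\<in>P. \<forall>q\<in>P. p \<noteq> q \<longrightarrow> (p, q) \<in> r \<longrightarrow> (g p, q) \<in> r)}"
  have "\<exists>P\<in>F. \<forall>X\<in>F. P \<subseteq> X \<longrightarrow> X = P"
  proof (rule subset_Zorn')
    fix C assume C: "subset.chain F C"
    then have CF: "C \<subseteq> F" unfolding subset.chain_def by blast
    have "(g p, q) \<in> r"
      if pq: "p \<in> X" "X \<in> C" "q \<in> Y" "Y \<in> C" "p \<noteq> q" "(p, q) \<in> r" for p q X Y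
    proof -
      have "X \<subseteq> Y \<or> Y \<subseteq> X"
        using C pq(2,4) unfolding subset.chain_def by blast
      then obtain Z where "Z \<in> C" "p \<in> Z" "q \<in> Z" using pq by blast
      then show ?thesis using CF pq(5,6) unfolding F_def by blast
    qed
    moreover have "\<Union>C \<subseteq> Field r" using CF unfolding F_def by blast
    ultimately show "\<Union>C \<in> F" unfolding F_def by (auto 0 0 simp only: mem_Collect_eq Union_iff)
  qed
  then obtain P where P: "P \<in> F" and maxi: "\<And>X. X \<in> F \<Longrightarrow> P \<subseteq> X \<Longrightarrow> X = P" by blast
  have PF: "P \<subseteq> Field r" using P unfolding F_def by blast
  have "cofinal P r"
  proof (rule ccontr)
    assume "\<not> cofinal P r"
    then obtain a where a: "a \<in> Field r" "\<forall>b\<in>P. a = b \<or> (a, b) \<notin> r"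
      unfolding cofinal_def by blast
    have "P \<subseteq> under r a"
    proof
      fix p assume "p \<in> P"
      then have "(p, a) \<in> r" using a PF by (intro Card_order_not_less[OF r]) auto
      then show "p \<in> under r a" unfolding under_def by blast
    qed
    then have 1: "|P| <o r"
      using card_of_mono1 card_of_under[OF r inf a(1)] ordLeq_ordLess_trans by blast
    then have "|g ` P| <o r" using card_of_image ordLeq_ordLess_trans by blast
    with 1 have "|P \<union> g ` P| <o r" by (rule card_of_Un_ordLess_infinite_Field[OF inf r])
    moreover have "P \<union> g ` P \<subseteq> Field r" using PF g by blast
    ultimately obtain b where b: "b \<in> Field r" "\<forall>k\<in>P \<union> g ` P. k \<in> underS r b"
      using regularCard_bounded[OF r inf reg] by blast
    have "insert b P \<in> F"
      unfolding F_def
    proof (intro CollectI conjI ballI impI)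
      show "insert b P \<subseteq> Field r" using PF b(1) by blast
      fix p q assume pq: "p \<in> insert b P" "q \<in> insert b P" "p \<noteq> q" "(p, q) \<in> r"
      \<comment> \<open>Since \<open>b\<close> lies strictly above \<open>P\<close>, it can only be
        the upper point of the pair.\<close>
      have "p \<noteq> b"
      proof
        assume "p = b"
        then have "q \<in> underS r b" using pq b(2) by blast
        with \<open>p = b\<close> pq(4) show False
          using Card_order_antisym[OF r, of b q] unfolding underS_def by blast
      qed
      then have "p \<in> P" using pq(1) by blast
      show "(g p, q) \<in> r"
      proof (cases "q = b")
        case True
        then show ?thesis using \<open>p \<in> P\<close> b(2) unfolding underS_def by blast
      next
        case False
        then show ?thesis using P pq \<open>p \<in> P\<close> unfolding F_def by blast
      qed
    qed
    then have "b \<in> P" using maxi[of "insert b P"] by blast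
    then show False using b unfolding underS_def by blast
  qed
  then have "|P| =o r" using reg PF unfolding regularCard_def by blast
  with PF show thesis
  proof (rule that)
    fix p q assume "p \<in> P" "q \<in> P" "p \<noteq> q" "(p, q) \<in> r"
    then show "(g p, q) \<in> r" using P unfolding F_def by blast
  qed
qed

lemma card_of_bounded_subsets:
  fixes r :: "'a rel"
  assumes r: "Card_order r" and inf: "infinite (Field r)" and pow: "is_weak_power_two r r"
  shows "|\<Union>\<beta>\<in>Field r. Pow (underS r \<beta>)| \<le>o r"
proof (rule card_of_UNION_ordLeq_infinite_Field[OF inf r])
  show "|Field r| \<le>o r" using card_of_Field_ordIso[OF r] ordIso_imp_ordLeq by blast
  have "|Pow (underS r \<beta>)| \<le>o r" if "\<beta> \<in> Field r" for \<beta>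
  proof -
    have "ctwo ^c |underS r \<beta>| \<le>o r"
      using pow card_of_underS[OF r that] card_of_Card_order
      unfolding is_weak_power_two_def is_card_Sup_def by blast
    then show ?thesis using Pow_ordIso_ctwo_cexp ordIso_ordLeq_trans by blast
  qed
  then show "\<forall>\<beta>\<in>Field r. |Pow (underS r \<beta>)| \<le>o r" by blast
qed

section \<open>Uniform ultrafilters and cofinal subsets of ordinals\<close>

lemma uniform_ultrafilter_eventually_above:
  assumes r: "Card_order r" and inf: "infinite (Field r)"
    and ult: "ultrafilter_on (Field r) U" and uni: "uniform_on r U" and b: "\<beta> \<in> Field r"
  shows "eventually (\<lambda>\<gamma>. \<beta> \<in> underS r \<gamma>) U"
proof -
  \<comment> \<open>Proper initial segments are too small for a uniform ultrafilter.\<close>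
  have "\<not> eventually (\<lambda>\<gamma>. \<gamma> \<in> under r \<beta>) U"
  proof
    assume "eventually (\<lambda>\<gamma>. \<gamma> \<in> under r \<beta>) U"
    moreover have "under r \<beta> \<subseteq> Field r" unfolding under_def Field_def by blast
    ultimately have "|under r \<beta>| =o r" using uni unfolding uniform_on_def by blast
    then show False using card_of_under[OF r inf b] not_ordLess_ordIso by blast
  qed
  then have "eventually (\<lambda>\<gamma>. \<gamma> \<notin> under r \<beta>) U"
    using ult unfolding ultrafilter_on_def by blast
  moreover have "eventually (\<lambda>\<gamma>. \<gamma> \<in> Field r) U"
    using ult unfolding ultrafilter_on_def le_principal by blast
  ultimately show ?thesis
  proof eventually_elim
    case (elim \<gamma>)
    then show ?case
      using Card_order_total[OF r elim(2) b] unfolding under_def underS_def by blast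
  qed
qed

lemma ordinal_at_cofinal_subset:
  assumes r: "Card_order r"
  obtains C where "C \<subseteq> underS r \<gamma>" "\<And>\<beta>. \<beta> \<in> underS r \<gamma> \<Longrightarrow> \<exists>c\<in>C. (\<beta>, c) \<in> r"
    "cofinality (ordinal_at r \<gamma>) = |C|"
proof -
  have wo: "Well_order r" using r unfolding card_order_on_def by blast
  have F: "Field (ordinal_at r \<gamma>) = underS r \<gamma>"
    using Card_order_refl[OF r] unfolding ordinal_at_def underS_def Field_def by blast
  obtain C where "unbounded_in C (ordinal_at r \<gamma>)" "cofinality (ordinal_at r \<gamma>) = |C|"
    using cofinality_witness[of "ordinal_at r \<gamma>"] Well_order_Restr[OF wo]
    unfolding ordinal_at_def by blast
  then show thesis
    unfolding unbounded_in_def F by (intro that[of C]) (auto simp: ordinal_at_def)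
qed

section \<open>The guessing sequence and its verification\<close>

theorem theorem2p3:
  fixes r :: "'a rel" and U :: "'a filter"
  assumes "weakly_inaccessible r"
    and "is_weak_power_two r r"
    and "weakly_normal r U"
    and "eventually (\<lambda>\<gamma>. \<gamma> \<in> {\<gamma> \<in> Field r. ctwo ^c cofinality (ordinal_at r \<gamma>) \<le>o ordinal_at r \<gamma>}) U"
  shows "diamond_minus r U"
proof -
  have r: "Card_order r" and reg: "regularCard r" and "natLeq <o r"
    using assms(1) unfolding weakly_inaccessible_def by auto
  then have inf: "infinite (Field r)"
    using cinfinite_mono[OF ordLess_imp_ordLeq natLeq_cinfinite] unfolding cinfinite_def by blast
  have ult: "ultrafilter_on (Field r) U" and uni: "uniform_on r U"
    and wn: "\<And>f. eventually (\<lambda>\<alpha>. f \<alpha> \<in> underS r \<alpha>) U \<Longrightarrow>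
        \<exists>\<beta>\<in>Field r. eventually (\<lambda>\<alpha>. f \<alpha> \<in> underS r \<beta>) U"
    using assms(3) unfolding weakly_normal_def by auto
  note above = uniform_ultrafilter_eventually_above[OF r inf ult uni]

  have "\<exists>C. C \<subseteq> underS r \<gamma> \<and> (\<forall>\<beta>\<in>underS r \<gamma>. \<exists>c\<in>C. (\<beta>, c) \<in> r) \<and>
      cofinality (ordinal_at r \<gamma>) = |C|" for \<gamma>
    by (rule ordinal_at_cofinal_subset[OF r, of \<gamma>]) blast
  then obtain C where C: "\<And>\<gamma>. C \<gamma> \<subseteq> underS r \<gamma>"
    "\<And>\<gamma> \<beta>. \<beta> \<in> underS r \<gamma> \<Longrightarrow> \<exists>c\<in>C \<gamma>. (\<beta>, c) \<in> r"
    "\<And>\<gamma>. cofinality (ordinal_at r \<gamma>) = |C \<gamma>|" by metis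

  \<comment> \<open>Choosing a point of \<open>C \<gamma>\<close> above \<beta> is regressive in
    \<gamma>, so weak normality bounds it by one \<beta>' almost everywhere; these bounds become
    \<open>g\<close>.\<close>
  have "\<exists>\<beta>'\<in>Field r. eventually (\<lambda>\<gamma>. \<exists>c\<in>C \<gamma>. (\<beta>, c) \<in> r \<and> c \<in> underS r \<beta>') U"
    if b: "\<beta> \<in> Field r" for \<beta>
  proof -
    define f where "f \<gamma> = (SOME c. c \<in> C \<gamma> \<and> (\<beta>, c) \<in> r)" for \<gamma>
    have f: "eventually (\<lambda>\<gamma>. f \<gamma> \<in> C \<gamma> \<and> (\<beta>, f \<gamma>) \<in> r) U"
      using above[OF b]
    proof eventually_elim
      case (elim \<gamma>)
      then have "\<exists>c. c \<in> C \<gamma> \<and> (\<beta>, c) \<in> r" using C(2) by blast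
      then show ?case unfolding f_def by (rule someI_ex)
    qed
    then have "eventually (\<lambda>\<gamma>. f \<gamma> \<in> underS r \<gamma>) U"
      by (rule eventually_mono) (use C(1) in blast)
    from wn[OF this] obtain \<beta>' where b': "\<beta>' \<in> Field r" "eventually (\<lambda>\<gamma>. f \<gamma> \<in> underS r \<beta>') U"
      by blast
    from f b'(2) have "eventually (\<lambda>\<gamma>. \<exists>c\<in>C \<gamma>. (\<beta>, c) \<in> r \<and> c \<in> underS r \<beta>') U"
      by eventually_elim blast
    with b'(1) show ?thesis by blast
  qed
  then have "\<forall>\<beta>\<in>Field r. \<exists>\<beta>'. \<beta>' \<in> Field r \<and>
      eventually (\<lambda>\<gamma>. \<exists>c\<in>C \<gamma>. (\<beta>, c) \<in> r \<and> c \<in> underS r \<beta>') U"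
    by blast
  from bchoice[OF this] obtain g where g: "\<And>\<beta>. \<beta> \<in> Field r \<Longrightarrow> g \<beta> \<in> Field r"
    "\<And>\<beta>. \<beta> \<in> Field r \<Longrightarrow> eventually (\<lambda>\<gamma>. \<exists>c\<in>C \<gamma>. (\<beta>, c) \<in> r \<and> c \<in> underS r (g \<beta>)) U"
    by blast

  obtain P where P: "P \<subseteq> Field r" "|P| =o r"
    and sparse: "\<And>p q. p \<in> P \<Longrightarrow> q \<in> P \<Longrightarrow> p \<noteq> q \<Longrightarrow> (p, q) \<in> r \<Longrightarrow> (g p, q) \<in> r"
    by (rule sparse_subset[OF r inf reg, of g]) (use g(1) in blast)+
  have "|\<Union>\<beta>\<in>Field r. Pow (underS r \<beta>)| \<le>o |P|"
    using card_of_bounded_subsets[OF r inf assms(2)] ordIso_symmetric[OF P(2)]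
    by (rule ordLeq_ordIso_trans)
  moreover have "(\<Union>\<beta>\<in>Field r. Pow (underS r \<beta>)) \<noteq> {}" using infinite_imp_nonempty[OF inf] by blast
  ultimately have "\<exists>a. a ` P = (\<Union>\<beta>\<in>Field r. Pow (underS r \<beta>))"
    by (rule iffD2[OF card_of_ordLeq2, rotated])
  then obtain a where a: "a ` P = (\<Union>\<beta>\<in>Field r. Pow (underS r \<beta>))" by blast

  define B where "B \<gamma> = {p \<in> P. \<exists>c\<in>C \<gamma>. (p, c) \<in> r \<and> c \<in> underS r (g p)}" for \<gamma>
  define T where "T \<gamma> = (\<lambda>D. \<Union>(a ` D) \<inter> underS r \<gamma>) ` Pow (B \<gamma>)" for \<gamma>
  \<comment> \<open>The default \<open>{}\<close> makes the size bound hold at every \<gamma>, not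
    only almost everywhere.\<close>
  define S where "S \<gamma> = (if |T \<gamma>| \<le>o ordinal_at r \<gamma> then T \<gamma> else {})" for \<gamma>

  have B_small: "|B \<gamma>| \<le>o |C \<gamma>|" for \<gamma>
  proof -
    have "\<exists>h. \<forall>p\<in>B \<gamma>. h p \<in> C \<gamma> \<and> (p, h p) \<in> r \<and> h p \<in> underS r (g p)"
      unfolding B_def by (rule bchoice) blast
    then obtain h where h: "\<And>p. p \<in> B \<gamma> \<Longrightarrow> h p \<in> C \<gamma> \<and> (p, h p) \<in> r \<and> h p \<in> underS r (g p)"
      by blast
    \<comment> \<open>Otherwise \<open>g p\<close> \<le> \<open>q\<close> \<le> \<open>h q\<close> =
      \<open>h p\<close> < \<open>g p\<close>.\<close>
    have less: "\<not> (p, q) \<in> r" if pq: "p \<in> B \<gamma>" "q \<in> B \<gamma>" "h p = h q" "p \<noteq> q" for p q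
    proof
      assume "(p, q) \<in> r"
      then have "(g p, q) \<in> r" using sparse pq unfolding B_def by blast
      then have "(g p, h p) \<in> r" using h[OF pq(2)] pq(3) Card_order_trans_weak[OF r] by metis
      then show False using h[OF pq(1)] Card_order_antisym[OF r] unfolding underS_def by blast
    qed
    have "inj_on h (B \<gamma>)"
    proof (rule inj_onI, rule ccontr)
      fix p q assume pq: "p \<in> B \<gamma>" "q \<in> B \<gamma>" "h p = h q" "p \<noteq> q"
      then have "p \<in> Field r" "q \<in> Field r" using P(1) unfolding B_def by auto
      then show False using less pq Card_order_total[OF r] by metis
    qed
    moreover have "h ` B \<gamma> \<subseteq> C \<gamma>" using h by blast
    ultimately show ?thesis using card_of_ordLeq by blast
  qed

  \<comment> \<open>Almost everywhere 2^|\<open>B \<gamma>\<close>| \<le> 2^cf(\<gamma>) \<le>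
    \<gamma>, so the default of \<open>S\<close> is avoided.\<close>
  have S_T: "eventually (\<lambda>\<gamma>. S \<gamma> = T \<gamma>) U"
    using assms(4)
  proof eventually_elim
    case (elim \<gamma>)
    have "|T \<gamma>| \<le>o |Pow (B \<gamma>)|" unfolding T_def by (rule card_of_image)
    also have "|Pow (B \<gamma>)| \<le>o |Pow (C \<gamma>)|" using B_small by (rule card_of_Pow_mono)
    also have "|Pow (C \<gamma>)| =o ctwo ^c |C \<gamma>|" by (rule Pow_ordIso_ctwo_cexp)
    also have "ctwo ^c |C \<gamma>| \<le>o ordinal_at r \<gamma>" using elim C(3) by auto
    finally show ?case unfolding S_def by simp
  qed

  have guess: "eventually (\<lambda>\<gamma>. A \<inter> underS r \<gamma> \<in> T \<gamma>) U" for A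
  proof (rule ccontr)
    assume "\<not> eventually (\<lambda>\<gamma>. A \<inter> underS r \<gamma> \<in> T \<gamma>) U"
    then have ev: "eventually (\<lambda>\<gamma>. A \<inter> underS r \<gamma> \<notin> T \<gamma>) U"
      using ult[unfolded ultrafilter_on_def] by (auto dest!: spec[of _ "{\<gamma>. A \<inter> underS r \<gamma> \<in> T \<gamma>}"])
    \<comment> \<open>\<open>D \<gamma>\<close> collects every available piece inside
      \<open>A\<close>. Its union cut off at \<gamma> is in \<open>T \<gamma>\<close>, so a failed
      guess means that it misses a point \<open>f \<gamma>\<close> of \<open>A\<close>.\<close>
    define D where "D \<gamma> = {p \<in> B \<gamma>. a p \<inter> underS r \<gamma> \<subseteq> A}" for \<gamma>
    define f where "f \<gamma> = (SOME x. x \<in> A \<inter> underS r \<gamma> \<and> x \<notin> \<Union>(a ` D \<gamma>))" for \<gamma>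
    have f: "eventually (\<lambda>\<gamma>. f \<gamma> \<in> A \<inter> underS r \<gamma> \<and> f \<gamma> \<notin> \<Union>(a ` D \<gamma>)) U"
      using ev
    proof eventually_elim
      case (elim \<gamma>)
      have "\<Union>(a ` D \<gamma>) \<inter> underS r \<gamma> \<in> T \<gamma>" unfolding T_def D_def by blast
      with elim have "A \<inter> underS r \<gamma> \<noteq> \<Union>(a ` D \<gamma>) \<inter> underS r \<gamma>" by metis
      then have "\<exists>x. x \<in> A \<inter> underS r \<gamma> \<and> x \<notin> \<Union>(a ` D \<gamma>)" unfolding D_def by blast
      then show ?case unfolding f_def by (rule someI_ex)
    qed
    then have "eventually (\<lambda>\<gamma>. f \<gamma> \<in> underS r \<gamma>) U" by (rule eventually_mono) blast
    from wn[OF this] obtain \<beta> where b: "\<beta> \<in> Field r" "eventually (\<lambda>\<gamma>. f \<gamma> \<in> underS r \<beta>) U"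
      by blast
    \<comment> \<open>Almost all missed points lie in the single bounded set
      \<open>A \<inter> underS r \<beta>\<close>, which is some \<open>a p\<close>. The choice of
      \<open>g\<close> puts this fixed \<open>p\<close> into \<open>B \<gamma>\<close> almost
      everywhere, so \<open>a p\<close> was among the pieces.\<close>
    have "A \<inter> underS r \<beta> \<in> a ` P" unfolding a using b(1) by blast
    then obtain p where p: "p \<in> P" "a p = A \<inter> underS r \<beta>" by force
    have "eventually (\<lambda>\<gamma>. p \<in> B \<gamma>) U"
      using g(2)[of p] p(1) P(1) unfolding B_def by auto
    with f b(2) have "eventually (\<lambda>\<gamma>. False) U"
    proof eventually_elim
      case (elim \<gamma>)
      then have "p \<in> D \<gamma>" unfolding D_def using p(2) by blast
      with elim p(2) show ?case by blast
    qed
    then show False using ult unfolding ultrafilter_on_def by (simp add: trivial_limit_def)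
  qed

  show ?thesis
    unfolding diamond_minus_def
  proof (intro exI[of _ S] conjI ballI allI impI)
    fix \<alpha> assume "\<alpha> \<in> Field r"
    have "Well_order (ordinal_at r \<alpha>)"
      using r Well_order_Restr unfolding card_order_on_def ordinal_at_def by blast
    then show "|S \<alpha>| \<le>o ordinal_at r \<alpha>" unfolding S_def by (simp add: card_of_empty1)
  next
    fix A :: "'a set"
    have "eventually (\<lambda>\<alpha>. \<alpha> \<in> Field r) U"
      using ult unfolding ultrafilter_on_def le_principal by blast
    with guess S_T have "eventually (\<lambda>\<alpha>. \<alpha> \<in> Field r \<and> A \<inter> underS r \<alpha> \<in> S \<alpha>) U"
      by eventually_elim simp
    \<comment> \<open>Properness turns guessing on a set in \<open>U\<close> into guessing on a
      positive set.\<close>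
    moreover have "U \<noteq> bot" using ult unfolding ultrafilter_on_def by blast
    ultimately show "frequently (\<lambda>\<alpha>. \<alpha> \<in> Field r \<and> A \<inter> underS r \<alpha> \<in> S \<alpha>) U"
      by (intro eventually_frequently)
  qed
qed

end
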